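(* There exist bounded sets $V_n\subset\mathbb{R}^2$ of finite (positive) measure, measurable with respect to the $\sigma$-algebra generated by $\mathcal{D}_n\times\mathcal{D}_n$ (the dyadic squares of side $2^{-n}$), such that $$\frac{\|\mathbf{S}\chi_{V_n}-\chi_{V_n}\|_{L^2(\mathbb{R}^2)}}{\|\chi_{V_n}\|_{L^2(\mathbb{R}^2)}}\longrightarrow 0\qquad\text{as }n\to\infty .$$
   Context: The dyadic grid: $\mathcal{D}_n=\{2^{-n}([0,1)+k):k\in\mathbb{Z}\}$ and $\mathcal{D}=\bigcup_{n\in\mathbb{Z}}\mathcal{D}_n$. For $I\in\mathcal{D}$, $I_+$ is its right half, $I_-$ its left half, and $h_I=|I|^{-1/2}(\chi_{I_+}-\chi_{I_-})$ is the $L^2$-normalized Haar function; $\{h_I\}_{I\in\mathcal{D}}$ is an orthonormal basis of $L^2(\mathbb{R})$. The dyadic shift $\mathcal{S}_0$ is the bounded linear operator on $L^2(\mathbb{R})$ determined by $\mathcal{S}_0h_{I_+}=h_{I_-}$ and $\mathcal{S}_0h_{I_-}=-h_{I_+}$ for all $I\in\mathcal{D}$. $\mathcal{S}_1,\mathcal{S}_2$ denote $\mathcal{S}_0$ acting in the first, respectively second, variable on $L^2(\mathbb{R}^2)$, and $\mathbf{S}=\mathcal{S}_2\mathcal{S}_1=\mathcal{S}_1\mathcal{S}_2$. *)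

theory Defs
  imports "HOL-Analysis.Analysis"
begin

definition dyadic_grid :: "int \<Rightarrow> real set set" where
  "dyadic_grid n = {(\<lambda>x. 2 powi (- n) * (x + of_int k)) ` {0..<1} | k :: int. True}"

definition dyadic_intervals :: "real set set" where
  "dyadic_intervals = (\<Union>n. dyadic_grid n)"

text \<open>The following two are meant for bounded intervals only.\<close>

definition left_half :: "real set \<Rightarrow> real set" where
  "left_half I = {x \<in> I. x < (Inf I + Sup I) / 2}"

definition right_half :: "real set \<Rightarrow> real set" where
  "right_half I = {x \<in> I. (Inf I + Sup I) / 2 \<le> x}"

definition haar :: "real set \<Rightarrow> real \<Rightarrow> real" where
  "haar I x = (indicator (right_half I) x - indicator (left_half I) x) / sqrt (measure lborel I)"

text \<open>
  Elements of \<open>L\<^sup>2\<close> are represented by measurable square-integrable functions, and an operator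
  on \<open>L\<^sup>2\<close> acts on representatives; equality of elements of \<open>L\<^sup>2\<close> is equality almost everywhere.
\<close>

definition L2 :: "'a measure \<Rightarrow> ('a \<Rightarrow> real) set" where
  "L2 M = {f \<in> borel_measurable M. integrable M (\<lambda>x. (f x)\<^sup>2)}"

definition L2_norm :: "'a measure \<Rightarrow> ('a \<Rightarrow> real) \<Rightarrow> real" where
  "L2_norm M f = sqrt (\<integral>x. (f x)\<^sup>2 \<partial>M)"

definition bounded_linear_L2 :: "'a measure \<Rightarrow> (('a \<Rightarrow> real) \<Rightarrow> ('a \<Rightarrow> real)) \<Rightarrow> bool" where
  "bounded_linear_L2 M T \<longleftrightarrow>
     (\<forall>f\<in>L2 M. T f \<in> L2 M) \<and>
     (\<forall>f\<in>L2 M. \<forall>g\<in>L2 M. (AE x in M. f x = g x) \<longrightarrow> (AE x in M. T f x = T g x)) \<and>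
     (\<forall>f\<in>L2 M. \<forall>g\<in>L2 M. AE x in M. T (\<lambda>z. f z + g z) x = T f x + T g x) \<and>
     (\<forall>f\<in>L2 M. \<forall>c. AE x in M. T (\<lambda>z. c * f z) x = c * T f x) \<and>
     (\<exists>C. \<forall>f\<in>L2 M. L2_norm M (T f) \<le> C * L2_norm M f)"

text \<open>
  Every dyadic interval is exactly one of the two halves of exactly one dyadic interval, so these
  conditions prescribe the values on the whole Haar basis and determine the operator uniquely,
  up to equality almost everywhere.
\<close>

definition is_dyadic_shift :: "((real \<Rightarrow> real) \<Rightarrow> (real \<Rightarrow> real)) \<Rightarrow> bool" where
  "is_dyadic_shift S0 \<longleftrightarrow>
     bounded_linear_L2 lborel S0 \<and>
     (\<forall>I\<in>dyadic_intervals.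
        (AE x in lborel. S0 (haar (right_half I)) x = haar (left_half I) x) \<and>
        (AE x in lborel. S0 (haar (left_half I)) x = - haar (right_half I) x))"

text \<open>
  The slices of a square-integrable function on the plane are square-integrable for almost every
  value of the frozen variable, so the conditions below determine the values of the operator on
  \<open>L\<^sup>2\<close> of the plane uniquely, up to equality almost everywhere.
\<close>

definition acts_in_first_variable ::
  "((real \<Rightarrow> real) \<Rightarrow> (real \<Rightarrow> real)) \<Rightarrow> ((real \<times> real \<Rightarrow> real) \<Rightarrow> (real \<times> real \<Rightarrow> real)) \<Rightarrow> bool" where
  "acts_in_first_variable T T1 \<longleftrightarrow>
     bounded_linear_L2 lborel T1 \<and>
     (\<forall>f\<in>L2 lborel. AE y in lborel. AE x in lborel. T1 f (x, y) = T (\<lambda>s. f (s, y)) x)"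

definition acts_in_second_variable ::
  "((real \<Rightarrow> real) \<Rightarrow> (real \<Rightarrow> real)) \<Rightarrow> ((real \<times> real \<Rightarrow> real) \<Rightarrow> (real \<times> real \<Rightarrow> real)) \<Rightarrow> bool" where
  "acts_in_second_variable T T2 \<longleftrightarrow>
     bounded_linear_L2 lborel T2 \<and>
     (\<forall>f\<in>L2 lborel. AE x in lborel. AE y in lborel. T2 f (x, y) = T (\<lambda>t. f (x, t)) y)"

definition dyadic_squares :: "int \<Rightarrow> (real \<times> real) set set" where
  "dyadic_squares n = {I \<times> J | I J. I \<in> dyadic_grid n \<and> J \<in> dyadic_grid n}"

end

theory Submission
  imports Defs
begin

text \<open>
  Take for \<open>V\<^sub>n\<close> the union of the diagonal squares \<open>I \<times> I\<close> with \<open>I \<in> \<D>\<^sub>n\<close>, \<open>I \<subseteq> [0,1)\<close>. Then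
  \<open>K\<^sub>n = 2\<^sup>n \<chi>\<^bsub>V\<^sub>n\<^esub>\<close> is the kernel of the conditional expectation onto the scale \<open>n\<close>, so \<open>K\<^sub>n\<^sub>+\<^sub>1 - K\<^sub>n\<close>
  is the sum of \<open>h\<^sub>J \<otimes> h\<^sub>J\<close> over \<open>J \<in> \<D>\<^sub>n\<close>, \<open>J \<subseteq> [0,1)\<close>. The operator \<open>S\<close> interchanges
  \<open>h\<^sub>J \<otimes> h\<^sub>J\<close> with \<open>h\<^sub>J\<^sub>' \<otimes> h\<^sub>J\<^sub>'\<close> for siblings \<open>J\<close>, \<open>J'\<close> (the two signs cancel), hence fixes
  this sum if \<open>n \<ge> 1\<close>. Therefore \<open>S K\<^sub>n - K\<^sub>n\<close> does not depend on \<open>n \<ge> 1\<close>, whereas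
  \<open>\<parallel>K\<^sub>n\<parallel> = 2\<^bsup>n/2\<^esup>\<close>.
\<close>

section \<open>Square-integrable functions and bounded operators on them\<close>

lemma bounded_linear_L2_closed:
  "bounded_linear_L2 M T \<Longrightarrow> f \<in> L2 M \<Longrightarrow> T f \<in> L2 M"
  and bounded_linear_L2_cong:
  "bounded_linear_L2 M T \<Longrightarrow> f \<in> L2 M \<Longrightarrow> g \<in> L2 M \<Longrightarrow> AE x in M. f x = g x
    \<Longrightarrow> AE x in M. T f x = T g x"
  and bounded_linear_L2_add:
  "bounded_linear_L2 M T \<Longrightarrow> f \<in> L2 M \<Longrightarrow> g \<in> L2 M
    \<Longrightarrow> AE x in M. T (\<lambda>z. f z + g z) x = T f x + T g x"
  and bounded_linear_L2_scale:
  "bounded_linear_L2 M T \<Longrightarrow> f \<in> L2 M \<Longrightarrow> AE x in M. T (\<lambda>z. c * f z) x = c * T f x"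
  unfolding bounded_linear_L2_def by blast+

lemma L2_measurable: "f \<in> L2 M \<Longrightarrow> f \<in> borel_measurable M"
  by (simp add: L2_def)

lemma L2_scale: "f \<in> L2 M \<Longrightarrow> (\<lambda>x. c * f x) \<in> L2 M"
  by (auto simp: L2_def power_mult_distrib)

lemma L2_add:
  assumes "f \<in> L2 M" "g \<in> L2 M"
  shows "(\<lambda>x. f x + g x) \<in> L2 M"
proof -
  have "integrable M (\<lambda>x. 2 * (f x)\<^sup>2 + 2 * (g x)\<^sup>2)"
    using assms by (auto simp: L2_def)
  moreover have "(f x + g x)\<^sup>2 \<le> 2 * (f x)\<^sup>2 + 2 * (g x)\<^sup>2" for x
    using sum_squares_bound[of "f x" "g x"] by (simp add: power2_sum)
  ultimately have "integrable M (\<lambda>x. (f x + g x)\<^sup>2)"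
    using assms by (elim Bochner_Integration.integrable_bound) (auto simp: L2_def)
  then show ?thesis
    using assms by (auto simp: L2_def)
qed

lemma L2_diff:
  assumes "f \<in> L2 M" "g \<in> L2 M"
  shows "(\<lambda>x. f x - g x) \<in> L2 M"
  using L2_add[OF assms(1) L2_scale[OF assms(2), of "-1"]] by simp

lemma L2_zero: "(\<lambda>x. 0) \<in> L2 M"
  by (simp add: L2_def)

lemma L2_sum:
  "(\<And>i. i \<in> A \<Longrightarrow> f i \<in> L2 M) \<Longrightarrow> (\<lambda>x. \<Sum>i\<in>A. f i x) \<in> L2 M"
  by (induction A rule: infinite_finite_induct) (auto simp: L2_zero intro: L2_add)

lemma L2_indicator:
  assumes "A \<in> sets M" "emeasure M A < \<infinity>"
  shows "indicator A \<in> L2 M"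
  using assms by (auto simp: L2_def power2_eq_square simp flip: indicator_inter_arith)

lemma L2_norm_cong_AE:
  assumes "f \<in> borel_measurable M" "g \<in> borel_measurable M" "AE x in M. f x = g x"
  shows "L2_norm M f = L2_norm M g"
  unfolding L2_norm_def using assms by (intro arg_cong[where f = sqrt] integral_cong_AE) auto

lemma L2_norm_scale: "L2_norm M (\<lambda>x. c * f x) = \<bar>c\<bar> * L2_norm M f"
  by (simp add: L2_norm_def power_mult_distrib real_sqrt_mult)

lemma L2_norm_indicator:
  assumes "A \<in> sets M"
  shows "L2_norm M (indicator A) = sqrt (measure M A)"
  using assms sets.sets_into_space[OF assms]
  by (simp add: L2_norm_def power2_eq_square Int_absorb2 Int_absorb1 flip: indicator_inter_arith)

text \<open>The linearity identities for \<open>U\<close> hold only almost everywhere, so each must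
  be carried through \<open>T\<close> by its compatibility with almost everywhere equality before
  the corresponding identity for \<open>T\<close> applies. This makes \<open>S2 \<circ> S1\<close> a
  single operator to which linearity can be applied.\<close>

lemma bounded_linear_L2_comp:
  assumes T: "bounded_linear_L2 M T" and U: "bounded_linear_L2 M U"
  shows "bounded_linear_L2 M (T \<circ> U)"
proof -
  note closed = bounded_linear_L2_closed[OF T] bounded_linear_L2_closed[OF U]
  have add: "AE x in M. T (U (\<lambda>z. f z + g z)) x = T (U f) x + T (U g) x"
    if "f \<in> L2 M" "g \<in> L2 M" for f g
  proof -
    have "AE x in M. T (U (\<lambda>z. f z + g z)) x = T (\<lambda>z. U f z + U g z) x"
      using that by (intro bounded_linear_L2_cong[OF T] bounded_linear_L2_add[OF U] closed L2_add)
    moreover have "AE x in M. T (\<lambda>z. U f z + U g z) x = T (U f) x + T (U g) x"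
      using that by (intro bounded_linear_L2_add[OF T] closed)
    ultimately show ?thesis by eventually_elim simp
  qed
  have scale: "AE x in M. T (U (\<lambda>z. c * f z)) x = c * T (U f) x" if "f \<in> L2 M" for f c
  proof -
    have "AE x in M. T (U (\<lambda>z. c * f z)) x = T (\<lambda>z. c * U f z) x"
      using that
      by (intro bounded_linear_L2_cong[OF T] bounded_linear_L2_scale[OF U] closed L2_scale)
    moreover have "AE x in M. T (\<lambda>z. c * U f z) x = c * T (U f) x"
      using that by (intro bounded_linear_L2_scale[OF T] closed)
    ultimately show ?thesis by eventually_elim simp
  qed
  obtain C where C: "\<And>f. f \<in> L2 M \<Longrightarrow> L2_norm M (T f) \<le> C * L2_norm M f"
    using T unfolding bounded_linear_L2_def by blast
  obtain D where D: "\<And>f. f \<in> L2 M \<Longrightarrow> L2_norm M (U f) \<le> D * L2_norm M f"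
    using U unfolding bounded_linear_L2_def by blast
  have "L2_norm M (T (U f)) \<le> (\<bar>C\<bar> * D) * L2_norm M f" if "f \<in> L2 M" for f
  proof -
    have nonneg: "0 \<le> L2_norm M g" for g :: "'a \<Rightarrow> real"
      by (simp add: L2_norm_def)
    \<comment> \<open>The constant \<open>C\<close> carries no sign condition. Its absolute value is
      still a bound because norms are nonnegative, and the bound for \<open>U\<close> may be
      multiplied by it.\<close>
    have "L2_norm M (T (U f)) \<le> \<bar>C\<bar> * L2_norm M (U f)"
      using C[OF closed(2)[OF that]] nonneg[of "U f"]
      by (meson abs_ge_self mult_right_mono order_trans)
    also have "\<dots> \<le> \<bar>C\<bar> * (D * L2_norm M f)"
      using D[OF that] by (simp add: mult_left_mono)
    finally show ?thesis by (simp add: mult.assoc)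
  qed
  then have "\<exists>C. \<forall>f\<in>L2 M. L2_norm M (T (U f)) \<le> C * L2_norm M f" by blast
  with add scale show ?thesis
    using bounded_linear_L2_cong[OF T] bounded_linear_L2_cong[OF U] closed
    unfolding bounded_linear_L2_def by (simp add: comp_def)
qed

lemma bounded_linear_L2_sum:
  assumes T: "bounded_linear_L2 M T" and f: "\<And>i. i \<in> A \<Longrightarrow> f i \<in> L2 M"
  shows "AE x in M. T (\<lambda>z. \<Sum>i\<in>A. f i z) x = (\<Sum>i\<in>A. T (f i) x)"
proof -
  \<comment> \<open>Homogeneity with scalar 0 gives the value at the zero function. It settles the
    empty sum and also an infinite index set, over which the sum is 0 by convention.\<close>
  have zero: "AE x in M. T (\<lambda>z. 0) x = 0"
    using bounded_linear_L2_scale[OF T L2_zero, of 0] by simp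
  show ?thesis
    using f
  proof (induction A rule: infinite_finite_induct)
    case (insert a A)
    have "AE x in M. T (\<lambda>z. \<Sum>i\<in>A. f i z) x = (\<Sum>i\<in>A. T (f i) x)"
      using insert by simp
    moreover have "AE x in M. T (\<lambda>z. f a z + (\<Sum>i\<in>A. f i z)) x
        = T (f a) x + T (\<lambda>z. \<Sum>i\<in>A. f i z) x"
      using insert by (intro bounded_linear_L2_add[OF T] L2_sum) auto
    ultimately have "AE x in M. T (\<lambda>z. f a z + (\<Sum>i\<in>A. f i z)) x = T (f a) x + (\<Sum>i\<in>A. T (f i) x)"
      by eventually_elim simp
    with insert.hyps show ?case by simp
  qed (use zero in auto)
qed

section \<open>Elementary tensors and operators acting in one variable\<close>

definition tensor :: "(real \<Rightarrow> real) \<Rightarrow> (real \<Rightarrow> real) \<Rightarrow> real \<times> real \<Rightarrow> real" where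
  "tensor f g p = f (fst p) * g (snd p)"

lemma L2_tensor:
  assumes "f \<in> L2 lborel" "g \<in> L2 lborel"
  shows "tensor f g \<in> L2 lborel"
proof -
  have [measurable]: "f \<in> borel_measurable lborel" "g \<in> borel_measurable lborel"
    using assms by (simp_all only: L2_measurable)
  have "integrable (lborel \<Otimes>\<^sub>M lborel) (\<lambda>(x, y). (f x)\<^sup>2 * (g y)\<^sup>2)"
    using assms by (intro lborel_pair.Fubini_integrable) (auto simp: L2_def)
  moreover have "tensor f g \<in> borel_measurable (lborel \<Otimes>\<^sub>M lborel)"
    unfolding tensor_def using assms[THEN L2_measurable] by measurable
  ultimately show ?thesis
    by (simp add: L2_def lborel_prod tensor_def power_mult_distrib case_prod_unfold)
qed

text \<open>For frozen \<open>y\<close> the slice of the tensor is the multiple \<open>g y\<close>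
  of \<open>f\<close>, so homogeneity of \<open>T\<close> computes the action on almost every slice.
  Fubini turns this into equality almost everywhere in the plane.\<close>

lemma acts_in_first_variable_tensor:
  assumes T: "bounded_linear_L2 lborel T" and T1: "acts_in_first_variable T T1"
    and f: "f \<in> L2 lborel" and g: "g \<in> L2 lborel" and k: "k \<in> L2 lborel"
    and Tf: "AE x in lborel. T f x = k x"
  shows "AE p in lborel. T1 (tensor f g) p = tensor k g p"
proof -
  have [measurable]: "T1 (tensor f g) \<in> borel_measurable (lborel \<Otimes>\<^sub>M lborel)"
    using T1 L2_tensor[OF f g] bounded_linear_L2_closed[THEN L2_measurable]
    unfolding acts_in_first_variable_def lborel_prod by blast
  have [measurable]: "tensor k g \<in> borel_measurable (lborel \<Otimes>\<^sub>M lborel)"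
    unfolding lborel_prod by (intro L2_measurable L2_tensor k g)
  have "AE y in lborel. AE x in lborel. T1 (tensor f g) (x, y) = T (\<lambda>s. tensor f g (s, y)) x"
    using T1 L2_tensor[OF f g] unfolding acts_in_first_variable_def by blast
  then have "AE y in lborel. AE x in lborel. T1 (tensor f g) (x, y) = tensor k g (x, y)"
  proof eventually_elim
    case (elim y)
    have "AE x in lborel. T (\<lambda>s. tensor f g (s, y)) x = g y * T f x"
      using bounded_linear_L2_scale[OF T f, of "g y"] by (simp add: tensor_def mult.commute)
    with elim Tf show ?case
      by eventually_elim (simp add: tensor_def)
  qed
  then have "AE x in lborel. AE y in lborel. T1 (tensor f g) (x, y) = tensor k g (x, y)"
    by (subst lborel_pair.AE_commute) measurable
  then have "AE p in lborel \<Otimes>\<^sub>M lborel. T1 (tensor f g) p = tensor k g p"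
    by (rule lborel_pair.AE_pair_measure[rotated]) measurable
  then show ?thesis
    by (simp only: lborel_prod)
qed

lemma acts_in_second_variable_tensor:
  assumes T: "bounded_linear_L2 lborel T" and T2: "acts_in_second_variable T T2"
    and f: "f \<in> L2 lborel" and g: "g \<in> L2 lborel" and k: "k \<in> L2 lborel"
    and Tg: "AE y in lborel. T g y = k y"
  shows "AE p in lborel. T2 (tensor f g) p = tensor f k p"
proof -
  have [measurable]: "T2 (tensor f g) \<in> borel_measurable (lborel \<Otimes>\<^sub>M lborel)"
    using T2 L2_tensor[OF f g] bounded_linear_L2_closed[THEN L2_measurable]
    unfolding acts_in_second_variable_def lborel_prod by blast
  have [measurable]: "tensor f k \<in> borel_measurable (lborel \<Otimes>\<^sub>M lborel)"
    unfolding lborel_prod by (intro L2_measurable L2_tensor f k)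
  have "AE x in lborel. AE y in lborel. T2 (tensor f g) (x, y) = T (\<lambda>t. tensor f g (x, t)) y"
    using T2 L2_tensor[OF f g] unfolding acts_in_second_variable_def by blast
  then have "AE x in lborel. AE y in lborel. T2 (tensor f g) (x, y) = tensor f k (x, y)"
  proof eventually_elim
    case (elim x)
    have "AE y in lborel. T (\<lambda>t. tensor f g (x, t)) y = f x * T g y"
      using bounded_linear_L2_scale[OF T g, of "f x"] by (simp add: tensor_def)
    with elim Tg show ?case
      by eventually_elim (simp add: tensor_def)
  qed
  then have "AE p in lborel \<Otimes>\<^sub>M lborel. T2 (tensor f g) p = tensor f k p"
    by (rule lborel_pair.AE_pair_measure[rotated]) measurable
  then show ?thesis
    by (simp only: lborel_prod)
qed

section \<open>Dyadic intervals of length at most 1 and their Haar functions\<close>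

text \<open>Natural indices reach only the intervals in the nonnegative half-line of length at most
  1, which include all those inside the unit interval. The halves of interval \<open>k\<close> get
  the indices \<open>2 * k\<close> and \<open>2 * k + 1\<close> one scale further.\<close>

definition dyadic_interval :: "nat \<Rightarrow> nat \<Rightarrow> real set" where
  "dyadic_interval n k = {real k / 2 ^ n..<(real k + 1) / 2 ^ n}"

lemma dyadic_interval_in_grid: "dyadic_interval n k \<in> dyadic_grid (int n)"
proof -
  have "(\<lambda>x. 2 powi (- int n) * (x + of_int (int k))) ` {0..<1} = dyadic_interval n k"
  proof (intro set_eqI iffI)
    fix x :: real
    assume "x \<in> dyadic_interval n k"
    then have "2 ^ n * x - real k \<in> {0..<1}"
      by (auto simp: dyadic_interval_def field_simps)
    moreover have "x = 2 powi (- int n) * ((2 ^ n * x - real k) + of_int (int k))"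
      by (simp add: power_int_minus field_simps)
    ultimately show "x \<in> (\<lambda>x. 2 powi (- int n) * (x + of_int (int k))) ` {0..<1}"
      by blast
  qed (auto simp: dyadic_interval_def power_int_minus field_simps)
  then show ?thesis
    unfolding dyadic_grid_def by blast
qed

lemma dyadic_interval_in_intervals: "dyadic_interval n k \<in> dyadic_intervals"
  using dyadic_interval_in_grid unfolding dyadic_intervals_def by blast

lemma sets_dyadic_interval [measurable]: "dyadic_interval n k \<in> sets borel"
  by (simp add: dyadic_interval_def)

lemma emeasure_dyadic_interval: "emeasure lborel (dyadic_interval n k) = ennreal (1 / 2 ^ n)"
  by (simp add: dyadic_interval_def divide_right_mono flip: diff_divide_distrib)

lemma measure_dyadic_interval: "measure lborel (dyadic_interval n k) = 1 / 2 ^ n"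
  by (simp add: measure_def emeasure_dyadic_interval)

lemma dyadic_interval_midpoint:
  "(Inf (dyadic_interval n k) + Sup (dyadic_interval n k)) / 2 = (2 * real k + 1) / 2 ^ Suc n"
proof -
  have "real k / 2 ^ n < (real k + 1) / 2 ^ n"
    by (simp add: divide_strict_right_mono)
  then show ?thesis
    by (simp add: dyadic_interval_def add_divide_distrib)
qed

lemma left_half_dyadic_interval:
  "left_half (dyadic_interval n k) = dyadic_interval (Suc n) (2 * k)"
  unfolding left_half_def dyadic_interval_midpoint by (auto simp: dyadic_interval_def field_simps)

lemma right_half_dyadic_interval:
  "right_half (dyadic_interval n k) = dyadic_interval (Suc n) (2 * k + 1)"
  unfolding right_half_def dyadic_interval_midpoint by (auto simp: dyadic_interval_def field_simps)

text \<open>Both indices are the integer part of \<open>2 ^ n * x\<close>.\<close>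

lemma disjoint_dyadic_interval:
  assumes "x \<in> dyadic_interval n j" "x \<in> dyadic_interval n k"
  shows "j = k"
proof -
  have "real j \<le> 2 ^ n * x" "2 ^ n * x < real j + 1" "real k \<le> 2 ^ n * x" "2 ^ n * x < real k + 1"
    using assms by (auto simp: dyadic_interval_def field_simps)
  then have "real j < real k + 1" "real k < real j + 1" by linarith+
  then show ?thesis by linarith
qed

lemma haar_dyadic_interval:
  "haar (dyadic_interval n k) x = sqrt (2 ^ n) *
     (indicator (dyadic_interval (Suc n) (2 * k + 1)) x - indicator (dyadic_interval (Suc n) (2 * k)) x)"
  by (simp add: haar_def left_half_dyadic_interval right_half_dyadic_interval measure_dyadic_interval
      real_sqrt_divide)

lemma L2_indicator_dyadic_interval: "indicator (dyadic_interval n k) \<in> L2 lborel"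
  by (rule L2_indicator) (auto simp: emeasure_dyadic_interval)

lemma L2_haar: "haar (dyadic_interval n k) \<in> L2 lborel"
  unfolding haar_dyadic_interval[abs_def] by (intro L2_scale L2_diff L2_indicator_dyadic_interval)

section \<open>Diagonal Haar tensors and their invariance under the double shift\<close>

definition haar_diag :: "nat \<Rightarrow> nat \<Rightarrow> real \<times> real \<Rightarrow> real" where
  "haar_diag n k = tensor (haar (dyadic_interval n k)) (haar (dyadic_interval n k))"

lemma L2_haar_diag: "haar_diag n k \<in> L2 lborel"
  unfolding haar_diag_def by (intro L2_tensor L2_haar)

text \<open>Each of \<open>S1\<close> and \<open>S2\<close> replaces one factor by the sibling's
  Haar function. Going from right to left produces no sign; going from left to right produces one
  minus sign per factor, and the two cancel. The scale is \<open>Suc n\<close> so that the siblings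
  are the halves of \<open>dyadic_interval n k\<close>.\<close>

lemma haar_diag_sibling:
  assumes S0: "is_dyadic_shift S0" and S1: "acts_in_first_variable S0 S1"
    and S2: "acts_in_second_variable S0 S2"
  shows "AE p in lborel. (S2 \<circ> S1) (haar_diag (Suc n) (2 * k + 1)) p = haar_diag (Suc n) (2 * k) p"
    and "AE p in lborel. (S2 \<circ> S1) (haar_diag (Suc n) (2 * k)) p = haar_diag (Suc n) (2 * k + 1) p"
proof -
  define l r where "l = haar (dyadic_interval (Suc n) (2 * k))"
    and "r = haar (dyadic_interval (Suc n) (2 * k + 1))"
  have lr: "l \<in> L2 lborel" "r \<in> L2 lborel" "(\<lambda>x. - r x) \<in> L2 lborel"
    using L2_haar L2_scale[OF L2_haar, of "-1"] by (simp_all add: l_def r_def)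
  have lin: "bounded_linear_L2 lborel S0" "bounded_linear_L2 lborel S1" "bounded_linear_L2 lborel S2"
    using assms
    by (simp_all add: is_dyadic_shift_def acts_in_first_variable_def acts_in_second_variable_def)
  have shift: "AE x in lborel. S0 r x = l x" "AE x in lborel. S0 l x = - r x"
    using S0 dyadic_interval_in_intervals[of n k]
    unfolding is_dyadic_shift_def l_def r_def
    by (auto simp flip: left_half_dyadic_interval right_half_dyadic_interval[simplified])
  \<comment> \<open>\<open>S1\<close> acts on the first factor, then \<open>S2\<close> on the
    second. The output of \<open>S1\<close> is known only almost everywhere, so it is passed to
    \<open>S2\<close> by congruence.\<close>
  have comp: "AE p in lborel. (S2 \<circ> S1) (tensor a a) p = tensor b b p"
    if a: "a \<in> L2 lborel" and b: "b \<in> L2 lborel" and ab: "AE x in lborel. S0 a x = b x" for a b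
  proof -
    have "AE p in lborel. S2 (S1 (tensor a a)) p = S2 (tensor b a) p"
      using a b ab
      by (intro bounded_linear_L2_cong[OF lin(3)] bounded_linear_L2_closed[OF lin(2)] L2_tensor
          acts_in_first_variable_tensor[OF lin(1) S1])
    moreover have "AE p in lborel. S2 (tensor b a) p = tensor b b p"
      using a b ab by (intro acts_in_second_variable_tensor[OF lin(1) S2])
    ultimately show ?thesis by eventually_elim simp
  qed
  show "AE p in lborel. (S2 \<circ> S1) (haar_diag (Suc n) (2 * k + 1)) p = haar_diag (Suc n) (2 * k) p"
    using comp[OF lr(2,1) shift(1)] by (simp add: haar_diag_def l_def r_def)
  have "tensor (\<lambda>x. - r x) (\<lambda>x. - r x) = tensor r r"
    by (auto simp: tensor_def)
  then show "AE p in lborel. (S2 \<circ> S1) (haar_diag (Suc n) (2 * k)) p = haar_diag (Suc n) (2 * k + 1) p"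
    using comp[OF lr(1,3) shift(2)] by (simp add: haar_diag_def l_def r_def)
qed

text \<open>Grouping by parity of the index pairs the two halves of each interval of the preceding
  scale.\<close>

lemma sum_lessThan_double:
  "(\<Sum>k<2 * m. f k) = (\<Sum>k<m. f (2 * k) + f (2 * k + 1))"
  for f :: "nat \<Rightarrow> 'a::comm_monoid_add"
  by (induction m) (simp_all add: add.assoc)

text \<open>The operator only swaps the two terms of each sibling pair. Scale 0 is excluded: its
  single interval [0,1) has the sibling [1,2), which does not occur in the sum.\<close>

lemma haar_diag_level_invariant:
  assumes S0: "is_dyadic_shift S0" and S1: "acts_in_first_variable S0 S1"
    and S2: "acts_in_second_variable S0 S2"
  shows "AE p in lborel. (S2 \<circ> S1) (\<lambda>q. \<Sum>k<2 ^ Suc n. haar_diag (Suc n) k q) p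
    = (\<Sum>k<2 ^ Suc n. haar_diag (Suc n) k p)"
proof -
  have "bounded_linear_L2 lborel (S2 \<circ> S1)"
    using S1 S2 by (intro bounded_linear_L2_comp)
      (simp_all add: acts_in_first_variable_def acts_in_second_variable_def)
  then have "AE p in lborel. (S2 \<circ> S1) (\<lambda>q. \<Sum>k<2 ^ Suc n. haar_diag (Suc n) k q) p
    = (\<Sum>k<2 ^ Suc n. (S2 \<circ> S1) (haar_diag (Suc n) k) p)"
    by (rule bounded_linear_L2_sum) (rule L2_haar_diag)
  \<comment> \<open>Countably many null sets are merged, so that one exceptional set serves all
    \<open>k\<close> at once.\<close>
  moreover have "AE p in lborel. \<forall>k. (S2 \<circ> S1) (haar_diag (Suc n) (2 * k + 1)) p = haar_diag (Suc n) (2 * k) p"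
    using haar_diag_sibling(1)[OF assms] by (simp add: AE_all_countable)
  moreover have "AE p in lborel. \<forall>k. (S2 \<circ> S1) (haar_diag (Suc n) (2 * k)) p = haar_diag (Suc n) (2 * k + 1) p"
    using haar_diag_sibling(2)[OF assms] by (simp add: AE_all_countable)
  ultimately show ?thesis
  proof eventually_elim
    case (elim p)
    have "(\<Sum>k<2 ^ Suc n. (S2 \<circ> S1) (haar_diag (Suc n) k) p)
        = (\<Sum>k<2 ^ n. haar_diag (Suc n) (2 * k + 1) p + haar_diag (Suc n) (2 * k) p)"
      unfolding power_Suc sum_lessThan_double elim(2)[rule_format] elim(3)[rule_format] ..
    also have "\<dots> = (\<Sum>k<2 ^ Suc n. haar_diag (Suc n) k p)"
      unfolding power_Suc sum_lessThan_double by (simp only: add.commute)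
    finally show ?case
      using elim(1) by (rule trans[rotated])
  qed
qed

section \<open>The sets along the diagonal\<close>

definition diagonal_squares :: "nat \<Rightarrow> (real \<times> real) set" where
  "diagonal_squares n = (\<Union>k<2 ^ n. dyadic_interval n k \<times> dyadic_interval n k)"

text \<open>The squares are disjoint, so at most one summand is nonzero at any point.\<close>

lemma indicator_diagonal_squares:
  "indicator (diagonal_squares n) p =
    (\<Sum>k<2 ^ n. tensor (indicator (dyadic_interval n k)) (indicator (dyadic_interval n k)) p)"
  (is "_ = (\<Sum>k<2 ^ n. ?t k p)")
proof (cases "p \<in> diagonal_squares n")
  case True
  then obtain j where j: "j < 2 ^ n" "fst p \<in> dyadic_interval n j" "snd p \<in> dyadic_interval n j"
    by (auto simp: diagonal_squares_def)
  \<comment> \<open>With \<open>j\<close> the index of the square containing \<open>p\<close>, the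
    first coordinate alone rules out every other index.\<close>
  have "?t k p = (if k = j then 1 else 0)" for k
  proof (cases "k = j")
    case True
    with j show ?thesis by (simp add: tensor_def)
  next
    case False
    then have "fst p \<notin> dyadic_interval n k"
      using j disjoint_dyadic_interval by blast
    with False show ?thesis by (simp add: tensor_def)
  qed
  then show ?thesis
    using j True by simp
next
  case False
  then have "?t k p = 0" if "k < 2 ^ n" for k
    using that by (cases p) (auto simp: tensor_def diagonal_squares_def indicator_def)
  then show ?thesis
    using False by simp
qed

text \<open>Let \<open>l\<close> and \<open>r\<close> be the indicators of the left and right half
  of one interval of scale \<open>n\<close>. Then 2 (\<open>l\<close> \<otimes> \<open>l\<close> +
  \<open>r\<close> \<otimes> \<open>r\<close>) is the sum of the tensor squares of
  \<open>l + r\<close> and \<open>r - l\<close>. Multiplied by \<open>2 ^ n\<close>, the first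
  square is the term of the coarser set and the second is the diagonal Haar tensor; it remains to
  sum over the intervals.\<close>

lemma indicator_diagonal_squares_Suc:
  "2 ^ Suc n * indicator (diagonal_squares (Suc n)) p =
    2 ^ n * indicator (diagonal_squares n) p + (\<Sum>k<2 ^ n. haar_diag n k p)"
proof -
  have split: "indicator (dyadic_interval n k) x = (indicator (dyadic_interval (Suc n) (2 * k)) x
      + indicator (dyadic_interval (Suc n) (2 * k + 1)) x :: real)" for k x
  proof -
    have "dyadic_interval n k = dyadic_interval (Suc n) (2 * k) \<union> dyadic_interval (Suc n) (2 * k + 1)"
      unfolding left_half_dyadic_interval[symmetric] right_half_dyadic_interval[symmetric]
      by (auto simp: left_half_def right_half_def)
    moreover have "dyadic_interval (Suc n) (2 * k) \<inter> dyadic_interval (Suc n) (2 * k + 1) = {}"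
      using disjoint_dyadic_interval[of _ "Suc n" "2 * k" "2 * k + 1"] by auto
    ultimately show ?thesis
      by (simp add: indicator_disj_union)
  qed
  have "2 ^ Suc n * (tensor (indicator (dyadic_interval (Suc n) (2 * k))) (indicator (dyadic_interval (Suc n) (2 * k))) p
      + tensor (indicator (dyadic_interval (Suc n) (2 * k + 1))) (indicator (dyadic_interval (Suc n) (2 * k + 1))) p)
    = 2 ^ n * tensor (indicator (dyadic_interval n k)) (indicator (dyadic_interval n k)) p
      + haar_diag n k p" for k
  proof -
    \<comment> \<open>The normalizing factors of the two Haar functions multiply to
      \<open>2 ^ n\<close>, the reciprocal of the interval length.\<close>
    have scale: "sqrt (2 ^ n) * a * (sqrt (2 ^ n) * b) = 2 ^ n * (a * b)" for a b :: real
    proof -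
      have "sqrt (2 ^ n) * a * (sqrt (2 ^ n) * b) = (sqrt (2 ^ n) * sqrt (2 ^ n)) * (a * b)"
        by (simp only: mult.assoc mult.left_commute)
      then show ?thesis by simp
    qed
    show ?thesis
      unfolding haar_diag_def tensor_def haar_dyadic_interval split[of k] scale
      by (simp add: algebra_simps)
  qed
  then show ?thesis
    by (simp only: indicator_diagonal_squares power_Suc[of _ n] sum_lessThan_double sum_distrib_left
        sum.distrib[symmetric])
qed

lemma sets_dyadic_square: "dyadic_interval n j \<times> dyadic_interval n k \<in> sets lborel"
  unfolding lborel_prod[symmetric] by (rule pair_measureI) simp_all

lemma sets_diagonal_squares: "diagonal_squares n \<in> sets lborel"
  unfolding diagonal_squares_def by (intro sets.finite_UN sets_dyadic_square) simp

text \<open>There are \<open>2 ^ n\<close> disjoint squares, each of area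
  \<open>1 / 2 ^ n * (1 / 2 ^ n)\<close>.\<close>

lemma emeasure_diagonal_squares: "emeasure lborel (diagonal_squares n) = ennreal (1 / 2 ^ n)"
proof -
  have sq: "emeasure lborel (dyadic_interval n k \<times> dyadic_interval n k) = ennreal (1 / 2 ^ n * (1 / 2 ^ n))" for k
    by (simp add: lborel.emeasure_pair_measure_Times emeasure_dyadic_interval flip: lborel_prod ennreal_mult)
  have "disjoint_family_on (\<lambda>k. dyadic_interval n k \<times> dyadic_interval n k) {..<2 ^ n}"
    using disjoint_dyadic_interval by (fastforce simp: disjoint_family_on_def)
  then have "emeasure lborel (diagonal_squares n)
      = (\<Sum>k<(2::nat) ^ n. emeasure lborel (dyadic_interval n k \<times> dyadic_interval n k))"
    unfolding diagonal_squares_def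
    by (intro sum_emeasure[symmetric] image_subsetI sets_dyadic_square finite_lessThan)
  also have "\<dots> = ennreal (\<Sum>k<(2::nat) ^ n. 1 / 2 ^ n * (1 / 2 ^ n))"
    unfolding sq by (rule sum_ennreal) simp
  finally show ?thesis by simp
qed

lemma bounded_diagonal_squares: "bounded (diagonal_squares n)"
  unfolding diagonal_squares_def dyadic_interval_def by (auto intro!: bounded_Times)

lemma diagonal_squares_in_sigma_sets:
  "diagonal_squares n \<in> sigma_sets UNIV (dyadic_squares (int n))"
  unfolding diagonal_squares_def
proof (rule sigma_sets_UNION)
  show "countable ((\<lambda>k. dyadic_interval n k \<times> dyadic_interval n k) ` {..<2 ^ n})"
    by simp
next
  fix Q
  assume "Q \<in> (\<lambda>k. dyadic_interval n k \<times> dyadic_interval n k) ` {..<2 ^ n}"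
  then have "Q \<in> dyadic_squares (int n)"
    using dyadic_interval_in_grid unfolding dyadic_squares_def by blast
  then show "Q \<in> sigma_sets UNIV (dyadic_squares (int n))"
    by (rule sigma_sets.Basic)
qed

section \<open>Constancy of the unnormalized defect and passage to the limit\<close>

theorem theorem2:
  fixes S0 :: "(real \<Rightarrow> real) \<Rightarrow> (real \<Rightarrow> real)"
    and S1 S2 :: "(real \<times> real \<Rightarrow> real) \<Rightarrow> (real \<times> real \<Rightarrow> real)"
  assumes "is_dyadic_shift S0"
    and "acts_in_first_variable S0 S1"
    and "acts_in_second_variable S0 S2"
  shows "\<exists>V :: nat \<Rightarrow> (real \<times> real) set.
    (\<forall>n. bounded (V n) \<and> 0 < emeasure lborel (V n) \<and> emeasure lborel (V n) < \<infinity> \<and>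
         V n \<in> sigma_sets UNIV (dyadic_squares (int n))) \<and>
    (\<lambda>n. L2_norm lborel (\<lambda>p. (S2 \<circ> S1) (indicator (V n)) p - indicator (V n) p)
         / L2_norm lborel (indicator (V n))) \<longlonglongrightarrow> 0"
proof (intro exI[of _ diagonal_squares] conjI allI)
  define S where "S = S2 \<circ> S1"
  define K :: "nat \<Rightarrow> real \<times> real \<Rightarrow> real" where "K n p = 2 ^ n * indicator (diagonal_squares n) p" for n p
  define H where "H n p = (\<Sum>k<2 ^ n. haar_diag n k p)" for n p
  define E where "E n = L2_norm lborel (\<lambda>p. S (K n) p - K n p)" for n
  have S: "bounded_linear_L2 lborel S"
    using assms(2,3) unfolding S_def
    by (intro bounded_linear_L2_comp)
      (simp_all add: acts_in_first_variable_def acts_in_second_variable_def)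
  have ind: "indicator (diagonal_squares n) \<in> L2 lborel" for n
    using sets_diagonal_squares by (intro L2_indicator) (auto simp: emeasure_diagonal_squares)
  have K: "K n \<in> L2 lborel" for n
    unfolding K_def[abs_def] by (intro L2_scale ind)
  have H: "H n \<in> L2 lborel" for n
    unfolding H_def[abs_def] by (intro L2_sum L2_haar_diag)
  have defect: "(\<lambda>p. S (K n) p - K n p) \<in> borel_measurable lborel" for n
    by (intro L2_measurable L2_diff bounded_linear_L2_closed[OF S] K)
  \<comment> \<open>Passing from \<open>K n\<close> to \<open>K (Suc n)\<close> adds
    \<open>H n\<close>, which \<open>S\<close> fixes, so it drops out of the defect. The restriction
    on \<open>n\<close> is the exclusion of scale 0 in the invariance of \<open>H n\<close>.\<close>
  have E_Suc: "E (Suc n) = E n" if "n \<ge> 1" for n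
    unfolding E_def
  proof (rule L2_norm_cong_AE[OF defect defect])
    have rec: "K (Suc n) = (\<lambda>p. K n p + H n p)"
      unfolding K_def H_def indicator_diagonal_squares_Suc by (rule refl)
    obtain m where "n = Suc m"
      using \<open>n \<ge> 1\<close> not0_implies_Suc[of n] by auto
    then have "AE p in lborel. S (H n) p = H n p"
      unfolding S_def H_def[abs_def] using haar_diag_level_invariant[OF assms] by blast
    moreover have "AE p in lborel. S (K (Suc n)) p = S (K n) p + S (H n) p"
      unfolding rec by (rule bounded_linear_L2_add[OF S K H])
    ultimately show "AE p in lborel. S (K (Suc n)) p - K (Suc n) p = S (K n) p - K n p"
      by eventually_elim (simp add: rec)
  qed
  have E_const: "E n = E 1" if "n \<ge> 1" for n
    using that by (induction n rule: dec_induct) (simp_all add: E_Suc)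
  \<comment> \<open>Undoing the factor \<open>2 ^ n\<close> divides the defect by
    \<open>2 ^ n\<close>, while the indicator has norm \<open>1 / sqrt 2 ^ n\<close>; the quotient
    keeps a factor \<open>1 / sqrt 2 ^ n\<close>.\<close>
  have ratio: "L2_norm lborel (\<lambda>p. S (indicator (diagonal_squares n)) p - indicator (diagonal_squares n) p)
      / L2_norm lborel (indicator (diagonal_squares n)) = E n / sqrt 2 ^ n" for n
  proof -
    have "AE p in lborel. S (K n) p = 2 ^ n * S (indicator (diagonal_squares n)) p"
      unfolding K_def[abs_def] by (rule bounded_linear_L2_scale[OF S ind])
    then have "AE p in lborel. S (K n) p - K n p
        = 2 ^ n * (S (indicator (diagonal_squares n)) p - indicator (diagonal_squares n) p)"
      by eventually_elim (simp add: K_def right_diff_distrib)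
    then have "E n = L2_norm lborel
        (\<lambda>p. 2 ^ n * (S (indicator (diagonal_squares n)) p - indicator (diagonal_squares n) p))"
      unfolding E_def
      by (intro L2_norm_cong_AE defect L2_measurable L2_scale L2_diff ind bounded_linear_L2_closed[OF S])
    also have "\<dots> = 2 ^ n * L2_norm lborel
        (\<lambda>p. S (indicator (diagonal_squares n)) p - indicator (diagonal_squares n) p)"
      by (simp add: L2_norm_scale)
    finally have E_eq: "E n = \<dots>" .
    have norm: "L2_norm lborel (indicator (diagonal_squares n)) = 1 / sqrt 2 ^ n"
      using sets_diagonal_squares
      by (simp add: L2_norm_indicator measure_def emeasure_diagonal_squares real_sqrt_divide real_sqrt_power)
    have pow: "(2::real) ^ n = sqrt 2 ^ n * sqrt 2 ^ n"
      by (simp flip: power_mult_distrib)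
    show ?thesis
      unfolding E_eq norm pow by simp
  qed
  have "(\<lambda>n. E 1 * (1 / sqrt 2) ^ n) \<longlonglongrightarrow> E 1 * 0"
    by (rule tendsto_mult_left[OF LIMSEQ_power_zero]) simp
  \<comment> \<open>The defect is known to be constant only from \<open>n = 1\<close> on, so the
    ratio is compared with the geometric sequence eventually, which suffices for the limit.\<close>
  moreover have "\<forall>\<^sub>F n in sequentially. E 1 * (1 / sqrt 2) ^ n = E n / sqrt 2 ^ n"
    using eventually_ge_at_top[of 1]
  proof eventually_elim
    case (elim n)
    show ?case
      unfolding E_const[OF elim] by (simp add: power_divide)
  qed
  ultimately have "(\<lambda>n. E n / sqrt 2 ^ n) \<longlonglongrightarrow> 0"
    by (simp add: tendsto_cong)
  then show "(\<lambda>n. L2_norm lborel (\<lambda>p. (S2 \<circ> S1) (indicator (diagonal_squares n)) p - indicator (diagonal_squares n) p)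
         / L2_norm lborel (indicator (diagonal_squares n))) \<longlonglongrightarrow> 0"
    by (simp only: ratio S_def[symmetric])
qed (simp_all add: bounded_diagonal_squares emeasure_diagonal_squares diagonal_squares_in_sigma_sets)

end
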